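(* Under any non-adaptive policy $\pi\in\Pi_N$, $$R(\pi,N)\le H\left(\mathrm{Bin}\left(k,\tfrac12\right)\right).$$
   Context: Setting. $\log$ is the logarithm to base 2. Let $k\ge 1$, $N\ge1$ be integers. $\theta=(\theta_1,\dots,\theta_k)$ is a random vector in $\mathbb R^k$ whose coordinates are i.i.d. with Lebesgue density $f_0$ on $\mathbb R$, so $\theta$ has density $p_0(u)=\prod_{i=1}^k f_0(u_i)$; the differential entropy $H_0=H(p_0)$ is assumed finite, where for a density $p$ on $\mathbb R^k$, $H(p)=-\int_{\mathbb R^k} p(u)\log p(u)\,du$. $Z$ is uniform on $[0,1]$ and independent of $\theta$. Policies. A policy is a sequence $\pi=(\pi_1,\dots,\pi_N)$ where $\pi_n$ is a Borel subset of $[0,1]\times\{0,1,\dots,k\}^{n-1}\times\mathbb R$; $\Pi$ is the set of all policies. Under $\pi$, the question sets and answers are defined recursively for $n=1,\dots,N$ by $A_n=\{t\in\mathbb R:(Z,X_1,\dots,X_{n-1},t)\in\pi_n\}$ and $X_n=\mathbb 1_{A_n}(\theta_1)+\dots+\mathbb 1_{A_n}(\theta_k)$. The set $\Pi_N\subset\Pi$ of non-adaptive policies consists of those policies under which each $A_n$ depends only on $Z$ (not on previous answers). Posterior and rate. $p_n$ is the conditional (posterior) density of $\theta$ given the history $B_n=(Z,A_1,\dots,A_n,X_1,\dots,X_n)$: $p_n(u)$ is proportional to $p_0(u)$ on the set $\{u\in\mathbb R^k: X_m=\sum_{i=1}^k\mathbb 1_{A_m}(u_i),\ 1\le m\le n\}$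 and is $0$ outside. The rate of reduction in expected entropy is $R(\pi,N)=\frac{H_0-E^\pi[H(p_N)]}{N}$. $H(\mathrm{Bin}(k,\frac12))$ is the discrete (Shannon, base 2) entropy of the Binomial distribution with parameters $k$ and $\frac12$. *)

theory Defs
  imports "HOL-Probability.Probability"
begin

text \<open>
  The number of targets is \<open>k = CARD('k)\<close>; a configuration of the targets is a vector
  of type \<open>real ^ 'k\<close>.  Questions are numbered \<open>1, \<dots>, N\<close>, so \<open>\<pi> n\<close> is meaningful only
  for \<open>n \<in> {1..N}\<close>.  An element of \<open>\<pi> n\<close> is a triple of the value of the auxiliary
  randomisation, the list \<open>[X\<^sub>1, \<dots>, X\<^sub>n\<^sub>-\<^sub>1]\<close> of previous answers, and a point of the line.
\<close>

type_synonym policy = "nat \<Rightarrow> (real \<times> nat list \<times> real) set"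

definition target_count :: "real set \<Rightarrow> real ^ 'k \<Rightarrow> nat" where
  "target_count A u = (\<Sum>i\<in>UNIV. indicator A (u $ i))"

text \<open>
  \<open>sets\<close> of the product measure below is the Borel algebra of
  \<open>[0,1] \<times> {0,\<dots>,k}\<^sup>n\<^sup>-\<^sup>1 \<times> \<real>\<close>; membership in it includes being a subset of that product.
\<close>

definition policies :: "nat \<Rightarrow> nat \<Rightarrow> policy set" where
  "policies k N = {\<pi>. \<forall>n\<in>{1..N}. \<pi> n \<in> sets
     (restrict_space borel {0..1} \<Otimes>\<^sub>M
      (count_space {xs. length xs = n - 1 \<and> set xs \<subseteq> {0..k}} \<Otimes>\<^sub>M borel))}"

text \<open>\<open>answers \<pi> z u n\<close> is \<open>[X\<^sub>1, \<dots>, X\<^sub>n]\<close> on the outcome \<open>Z = z\<close>, \<open>\<theta> = u\<close>.\<close>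

primrec answers :: "policy \<Rightarrow> real \<Rightarrow> real ^ 'k \<Rightarrow> nat \<Rightarrow> nat list" where
  "answers \<pi> z u 0 = []"
| "answers \<pi> z u (Suc n) =
     answers \<pi> z u n @ [target_count {t. (z, answers \<pi> z u n, t) \<in> \<pi> (Suc n)} u]"

definition question_set :: "policy \<Rightarrow> real \<Rightarrow> real ^ 'k \<Rightarrow> nat \<Rightarrow> real set" where
  "question_set \<pi> z u n = {t. (z, answers \<pi> z u (n - 1), t) \<in> \<pi> n}"

definition answer :: "policy \<Rightarrow> real \<Rightarrow> real ^ 'k \<Rightarrow> nat \<Rightarrow> nat" where
  "answer \<pi> z u n = target_count (question_set \<pi> z u n) u"

text \<open>The type argument only supplies the dimension.\<close>

definition non_adaptive_policies :: "'k::finite itself \<Rightarrow> nat \<Rightarrow> policy set" where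
  "non_adaptive_policies _ N = {\<pi> \<in> policies CARD('k) N.
     \<forall>n\<in>{1..N}. \<forall>z\<in>{0..1}. \<forall>(u :: real ^ 'k) (v :: real ^ 'k).
       question_set \<pi> z u n = question_set \<pi> z v n}"

definition iid_density :: "(real \<Rightarrow> real) \<Rightarrow> real ^ 'k \<Rightarrow> real" where
  "iid_density f u = (\<Prod>i\<in>UNIV. f (u $ i))"

text \<open>
  The configurations that are compatible with the first \<open>n\<close> questions and answers observed
  on the outcome \<open>Z = z\<close>, \<open>\<theta> = u\<close>: the observed question sets are held fixed.
\<close>

definition consistent :: "policy \<Rightarrow> real \<Rightarrow> real ^ 'k \<Rightarrow> nat \<Rightarrow> (real ^ 'k) set" where
  "consistent \<pi> z u n =
     {v. \<forall>m\<in>{1..n}. answer \<pi> z u m = target_count (question_set \<pi> z u m) v}"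

text \<open>
  If the observed history has prior probability \<open>0\<close>, the posterior density is \<open>0\<close>
  (division by zero); this happens only on a null set of outcomes.
\<close>

definition posterior ::
    "(real ^ 'k \<Rightarrow> real) \<Rightarrow> policy \<Rightarrow> real \<Rightarrow> real ^ 'k \<Rightarrow> nat \<Rightarrow> real ^ 'k \<Rightarrow> real" where
  "posterior p0 \<pi> z u n v =
     indicator (consistent \<pi> z u n) v * p0 v / (\<integral>w. indicator (consistent \<pi> z u n) w * p0 w \<partial>lborel)"

text \<open>The integrand vanishes where \<open>p = 0\<close>, which is the convention \<open>0 log 0 = 0\<close>.\<close>

definition differential_entropy :: "(real ^ 'k \<Rightarrow> real) \<Rightarrow> real" where
  "differential_entropy p = - (\<integral>u. p u * log 2 (p u) \<partial>lborel)"

definition shannon_entropy :: "'a pmf \<Rightarrow> real" where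
  "shannon_entropy p = - (\<Sum>\<^sub>\<infinity>x\<in>set_pmf p. pmf p x * log 2 (pmf p x))"

definition reduction_rate ::
    "'a measure \<Rightarrow> (real ^ 'k \<Rightarrow> real) \<Rightarrow> ('a \<Rightarrow> real) \<Rightarrow> ('a \<Rightarrow> real ^ 'k) \<Rightarrow> policy \<Rightarrow> nat \<Rightarrow> real" where
  "reduction_rate M p0 Z \<theta> \<pi> N =
     (differential_entropy p0
        - (\<integral>\<omega>. differential_entropy (posterior p0 \<pi> (Z \<omega>) (\<theta> \<omega>) N) \<partial>M)) / real N"

end

theory Submission
  imports Defs
begin

text \<open>
  Given \<open>Z = z\<close>, a non-adaptive policy asks fixed questions, so the answer vector \<open>X\<close> is a function
  of \<open>\<theta>\<close> and conditioning on it reduces the expected entropy by exactly \<open>H(X | Z = z)\<close>. This is at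
  most the sum of the entropies of the single answers. Each of them is \<open>Bin(k, q)\<close>-distributed for
  some \<open>q\<close>, and the binomial entropy, being concave in \<open>q\<close> and invariant under \<open>q \<mapsto> 1 - q\<close>, is
  largest at \<open>q = 1/2\<close>.
\<close>

section \<open>Concavity of the binomial entropy\<close>

text \<open>Non-adaptivity enters twice. The outcomes that share a history are the level sets of a
  single map of \<theta>, and every question set is a fixed Borel set, so the number of i.i.d.
  targets in it is exactly binomial. Concavity cannot be checked term by term: -p^2 ln (p^2), the
  last term for n = 2, is convex near 0. The mean of -ln (n choose J) is in fact convex in p, and
  the concave part -n (p ln p + (1 - p) ln (1 - p)) has to outweigh it. The expected posterior
  entropy is a Bochner integral, which would silently be 0 without integrability. The proof
  therefore also bounds the expected absolute value of the posterior entropy uniformly in z and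
  proves joint measurability in (z, u).\<close>

text \<open>This is the expectation E[f(J)] for J \<sim> Bin(n, p), written as a polynomial in p so
  that it can be differentiated.\<close>

definition bernstein_mean :: "nat \<Rightarrow> (nat \<Rightarrow> real) \<Rightarrow> real \<Rightarrow> real" where
  "bernstein_mean n f p = (\<Sum>j\<le>n. Bernstein n j p * f j)"

lemma Bernstein_Suc_Suc:
  "Bernstein (Suc n) (Suc j) p = p * Bernstein n j p + (1 - p) * Bernstein n (Suc j) p"
proof (cases "j < n")
  case True
  then have "n - j = Suc (n - Suc j)" by simp
  then show ?thesis by (simp add: Bernstein_def algebra_simps)
next
  case False
  then show ?thesis by (simp add: Bernstein_def binomial_eq_0)
qed

lemma bernstein_mean_0 [simp]: "bernstein_mean 0 f p = f 0"
  by (simp add: bernstein_mean_def Bernstein_def)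

text \<open>Condition on one of the n + 1 trials: a success shifts the argument of \<open>f\<close>
  by one.\<close>

lemma bernstein_mean_Suc:
  "bernstein_mean (Suc n) f p
     = p * bernstein_mean n (\<lambda>j. f (Suc j)) p + (1 - p) * bernstein_mean n f p"
proof -
  have 0: "Bernstein (Suc n) 0 p = (1 - p) * Bernstein n 0 p" "Bernstein n (Suc n) p = 0"
    by (simp_all add: Bernstein_def)
  \<comment> \<open>The extra summand is 0; with it, the shift of indices leaves a sum over the same
    range as the other sums.\<close>
  have "bernstein_mean n f p = (\<Sum>j\<le>Suc n. Bernstein n j p * f j)"
    using 0 by (simp add: bernstein_mean_def)
  also have "\<dots> = Bernstein n 0 p * f 0 + (\<Sum>j\<le>n. Bernstein n (Suc j) p * f (Suc j))"
    by (rule sum.atMost_Suc_shift)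
  finally have 1: "bernstein_mean n f p = \<dots>" .
  have "bernstein_mean (Suc n) f p
      = Bernstein (Suc n) 0 p * f 0 + (\<Sum>j\<le>n. Bernstein (Suc n) (Suc j) p * f (Suc j))"
    unfolding bernstein_mean_def by (rule sum.atMost_Suc_shift)
  also have "\<dots> = (1 - p) * (Bernstein n 0 p * f 0 + (\<Sum>j\<le>n. Bernstein n (Suc j) p * f (Suc j)))
      + p * (\<Sum>j\<le>n. Bernstein n j p * f (Suc j))"
    by (simp add: 0 Bernstein_Suc_Suc algebra_simps sum.distrib sum_subtractf sum_distrib_left)
  finally show ?thesis
    using 1 by (simp add: bernstein_mean_def)
qed

lemma bernstein_mean_diff:
  "bernstein_mean n f p - bernstein_mean n g p = bernstein_mean n (\<lambda>j. f j - g j) p"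
  by (simp add: bernstein_mean_def sum_subtractf algebra_simps)

text \<open>Raising the success probability of one trial changes the mean of f(J) by that of f(J' +
  1) - f(J'), where J' counts the other n - 1 trials. The induction peels off a trial and the
  product rule supplies this difference. At n = 0 the factor n makes the truncated n - 1
  harmless.\<close>

lemma bernstein_mean_has_derivative:
  "(bernstein_mean n f has_real_derivative
      real n * bernstein_mean (n - 1) (\<lambda>j. f (Suc j) - f j) p) (at p)"
proof (induction n arbitrary: f)
  case 0
  have "bernstein_mean 0 f = (\<lambda>p. f 0)" by auto
  then show ?case by simp
next
  case (Suc n)
  let ?d = "\<lambda>f j. f (Suc j) - f j :: real"
  have eq: "bernstein_mean (Suc n) f
      = (\<lambda>p. p * bernstein_mean n (\<lambda>j. f (Suc j)) p + (1 - p) * bernstein_mean n f p)"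
    by (simp add: fun_eq_iff bernstein_mean_Suc)
  \<comment> \<open>The recursion read backwards: it merges the two derivatives given by the
    induction hypothesis into one mean over n trials.\<close>
  have split: "real n * bernstein_mean n g p
      = p * (real n * bernstein_mean (n - 1) (\<lambda>j. g (Suc j)) p)
        + (1 - p) * (real n * bernstein_mean (n - 1) g p)" for g
    by (cases n) (simp_all add: bernstein_mean_Suc algebra_simps)
  show ?case
    unfolding eq
    apply (rule DERIV_cong)
     apply (rule DERIV_add DERIV_mult Suc.IH DERIV_diff DERIV_const DERIV_ident)+
    using split[of "?d f"] bernstein_mean_diff[of n "\<lambda>j. f (Suc j)" p f]
    by (simp add: algebra_simps)
qed

lemma bernstein_mean_mono:
  assumes "0 \<le> p" "p \<le> 1" "\<And>j. j \<le> n \<Longrightarrow> f j \<le> g j"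
  shows "bernstein_mean n f p \<le> bernstein_mean n g p"
  unfolding bernstein_mean_def
  using assms by (intro sum_mono mult_left_mono Bernstein_nonneg) auto

lemma bernstein_mean_reflect:
  "bernstein_mean n f (1 - p) = bernstein_mean n (\<lambda>j. f (n - j)) p"
  unfolding bernstein_mean_def
  by (rule sum.reindex_bij_witness[of _ "\<lambda>j. n - j" "\<lambda>j. n - j"])
     (auto simp: Bernstein_def binomial_symmetric[symmetric])

text \<open>Absorption, (n + 1) (n choose j) / (j + 1) = (n + 1 choose j + 1), turns p times the
  left side into the probability that Bin(n + 1, p) is nonzero. Only the mass at 0 is lost in the
  inequality.\<close>

lemma bernstein_mean_inverse_Suc:
  assumes "0 < p" "p < 1"
  shows "real (Suc n) * bernstein_mean n (\<lambda>j. 1 / real (Suc j)) p \<le> 1 / p"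
proof -
  have *: "p * (real (Suc n) * (Bernstein n j p * (1 / real (Suc j)))) = Bernstein (Suc n) (Suc j) p"
    for j
  proof -
    have "real (Suc n) * real (n choose j) = real (Suc n choose Suc j) * real (Suc j)"
      using Suc_times_binomial_eq[of n j] by (metis of_nat_mult)
    then have "real (Suc n) * real (n choose j) / real (Suc j) = real (Suc n choose Suc j)"
      by (metis nonzero_mult_div_cancel_right of_nat_neq_0)
    moreover have "p * (real (Suc n) * (Bernstein n j p * (1 / real (Suc j))))
       = (real (Suc n) * real (n choose j) / real (Suc j)) * (p * p ^ j * (1 - p) ^ (n - j))"
      by (simp add: Bernstein_def)
    ultimately show ?thesis
      by (simp only:) (simp add: Bernstein_def)
  qed
  have "p * (real (Suc n) * bernstein_mean n (\<lambda>j. 1 / real (Suc j)) p)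
      = (\<Sum>j\<le>n. Bernstein (Suc n) (Suc j) p)"
    unfolding bernstein_mean_def sum_distrib_left * ..
  also have "\<dots> \<le> Bernstein (Suc n) 0 p + \<dots>"
    using assms by (simp add: Bernstein_def)
  also have "\<dots> = 1"
    using sum_Bernstein[of "Suc n" p] unfolding sum.atMost_Suc_shift .
  finally show ?thesis
    using assms by (simp add: field_simps)
qed

section \<open>Entropy of the binomial law as a function of its parameter\<close>

text \<open>Natural logarithms keep the derivatives free of constants;
  \<open>shannon_entropy_binomial_pmf\<close> converts to base 2.\<close>

definition binomial_entropy :: "nat \<Rightarrow> real \<Rightarrow> real" where
  "binomial_entropy n p = - (\<Sum>j\<le>n. Bernstein n j p * ln (Bernstein n j p))"

text \<open>Apart from ln (n choose j), the logarithm of a binomial weight is affine in j, and the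
  mean of J is n p. This leaves the mean of ln (n choose J) as the only part of unknown
  curvature.\<close>

lemma binomial_entropy_eq:
  assumes "0 < p" "p < 1"
  shows "binomial_entropy n p = - bernstein_mean n (\<lambda>j. ln (real (n choose j))) p
           - real n * (p * ln p + (1 - p) * ln (1 - p))"
proof -
  have "(\<Sum>j\<le>n. Bernstein n j p * ln (Bernstein n j p))
      = (\<Sum>j\<le>n. Bernstein n j p * ln (real (n choose j)) + real j * Bernstein n j p * ln p
           + (real n - real j) * Bernstein n j p * ln (1 - p))"
  proof (rule sum.cong[OF refl])
    fix j assume "j \<in> {..n}"
    then have j: "j \<le> n" by simp
    then have *: "ln (Bernstein n j p)
        = ln (real (n choose j)) + real j * ln p + real (n - j) * ln (1 - p)"
      using assms by (simp add: Bernstein_def ln_mult ln_realpow)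
    show "Bernstein n j p * ln (Bernstein n j p)
      = Bernstein n j p * ln (real (n choose j)) + real j * Bernstein n j p * ln p
           + (real n - real j) * Bernstein n j p * ln (1 - p)"
      unfolding * using j by (simp add: of_nat_diff distrib_left mult_ac)
  qed
  also have "\<dots> = bernstein_mean n (\<lambda>j. ln (real (n choose j))) p
      + (\<Sum>j\<le>n. real j * Bernstein n j p) * ln p
      + (real n * (\<Sum>j\<le>n. Bernstein n j p) - (\<Sum>j\<le>n. real j * Bernstein n j p)) * ln (1 - p)"
    by (simp add: bernstein_mean_def sum.distrib sum_subtractf sum_distrib_left sum_distrib_right
        left_diff_distrib del: sum_Bernstein sum_k_Bernstein)
  finally show ?thesis
    by (simp add: binomial_entropy_def algebra_simps)
qed

lemma binomial_entropy_reflect: "binomial_entropy n (1 - p) = binomial_entropy n p"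
  unfolding binomial_entropy_def
  by (intro arg_cong[of _ _ uminus] sum.reindex_bij_witness[of _ "\<lambda>j. n - j" "\<lambda>j. n - j"])
     (auto simp: Bernstein_def binomial_symmetric[symmetric] mult.commute mult.left_commute)

lemma ln_binomial_step:
  assumes "j < n"
  shows "ln (real (n choose Suc j)) - ln (real (n choose j)) = ln (real (n - j)) - ln (real (Suc j))"
proof -
  have "real (Suc j) * real (n choose Suc j) = real (n choose j) * real (n - j)"
    using binomial_absorb_comp[of n j] binomial_absorption[of j n]
    by (metis mult.commute of_nat_mult)
  then have "ln (real (Suc j) * real (n choose Suc j)) = ln (real (n choose j) * real (n - j))"
    by simp
  then show ?thesis
    using assms by (subst (asm) (1 2) ln_mult) (auto simp: zero_less_binomial_iff)
qed

text \<open>By \<open>ln_binomial_step\<close> the left side is (ln (j + 2) - ln (j + 1)) + (ln (n -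
  j + 2) - ln (n - j + 1)), and ln (1 + x) \<le> x bounds both parts. The upper index n + 2 accounts
  for the two trials lost by differentiating twice.\<close>

lemma ln_binomial_second_difference:
  assumes "j \<le> n"
  shows "- ((ln (real (Suc (Suc n) choose Suc (Suc j))) - ln (real (Suc (Suc n) choose Suc j)))
            - (ln (real (Suc (Suc n) choose Suc j)) - ln (real (Suc (Suc n) choose j))))
         \<le> 1 / real (Suc j) + 1 / real (Suc (n - j))"
proof -
  have ln_bound: "ln (real (Suc (Suc m))) - ln (real (Suc m)) \<le> 1 / real (Suc m)" for m
  proof -
    have "ln (real (Suc (Suc m))) - ln (real (Suc m)) = ln (real (Suc (Suc m)) / real (Suc m))"
      by (subst ln_div) auto
    also have "real (Suc (Suc m)) / real (Suc m) = 1 + 1 / real (Suc m)"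
      by (simp add: field_simps)
    also have "ln \<dots> \<le> 1 / real (Suc m)"
      by (rule ln_add_one_self_le_self) simp
    finally show ?thesis .
  qed
  have "Suc (Suc n) - Suc j = Suc (n - j)" "Suc (Suc n) - j = Suc (Suc (n - j))"
    using assms by auto
  then show ?thesis
    using ln_binomial_step[of j "Suc (Suc n)"] ln_binomial_step[of "Suc j" "Suc (Suc n)"]
      ln_bound[of j] ln_bound[of "n - j"] assms
    by (simp del: of_nat_Suc binomial_Suc_Suc)
qed

text \<open>With \<open>c j = ln (n choose j)\<close>, the second derivative is
  \<open>- n (n - 1) E[\<Delta>\<^sup>2 c (J)] - n / (p (1 - p))\<close> for \<open>J \<sim> Bin(n - 2, p)\<close>. Since
  \<open>- \<Delta>\<^sup>2 c (j) \<le> 1 / (j + 1) + 1 / (n - 1 - j)\<close> and \<open>(n - 1) E[1 / (J + 1)] \<le> 1 / p\<close>, it is nonpositive.\<close>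

lemma binomial_entropy_concave: "concave_on {0<..<1} (binomial_entropy n)"
proof -
  define c where "c j = ln (real (n choose j))" for j
  define G where "G p = - bernstein_mean n c p - real n * (p * ln p + (1 - p) * ln (1 - p))" for p
  define G' where "G' p = - (real n * bernstein_mean (n - 1) (\<lambda>j. c (Suc j) - c j) p)
    - real n * (ln p - ln (1 - p))" for p
  define d2 where "d2 j = (c (Suc (Suc j)) - c (Suc j)) - (c (Suc j) - c j)" for j
  define G'' where "G'' p = - (real n * (real (n - 1) * bernstein_mean (n - 2) d2 p))
    - real n * (1 / p + 1 / (1 - p))" for p
  have "concave_on {0<..<1} G"
  proof (rule f''_le0_imp_concave)
    show "convex {0<..<1::real}" by simp
  next
    fix p :: real assume "p \<in> {0<..<1}"
    then have p: "0 < p" "p < 1" by auto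
    have 1: "((\<lambda>p. p * ln p + (1 - p) * ln (1 - p)) has_real_derivative (ln p - ln (1 - p))) (at p)"
      using p by (auto intro!: derivative_eq_intros)
    show "(G has_real_derivative G' p) (at p)"
      unfolding G_def[abs_def] G'_def
      by (intro DERIV_diff DERIV_minus DERIV_cmult bernstein_mean_has_derivative 1)
    have 2: "((\<lambda>p. ln p - ln (1 - p)) has_real_derivative (1 / p + 1 / (1 - p))) (at p)"
      using p by (auto intro!: derivative_eq_intros simp: divide_simps)
    have 3: "(bernstein_mean (n - 1) (\<lambda>j. c (Suc j) - c j) has_real_derivative
        real (n - 1) * bernstein_mean (n - 2) d2 p) (at p)"
      unfolding d2_def using bernstein_mean_has_derivative[of "n - 1" "\<lambda>j. c (Suc j) - c j" p]
      by (simp add: numeral_2_eq_2)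
    show "(G' has_real_derivative G'' p) (at p)"
      unfolding G'_def[abs_def] G''_def
      by (intro DERIV_diff DERIV_minus DERIV_cmult 2 3)
    \<comment> \<open>With the factor n removed, the right side is the concave share of
      \<open>G''\<close>, which must outweigh the left side. For n \<le> 1, where n - 2 would
      truncate, the left side is 0.\<close>
    have "- (real (n - 1) * bernstein_mean (n - 2) d2 p) \<le> 1 / p + 1 / (1 - p)"
    proof (cases "n \<le> 1")
      case True
      then have "n - 1 = 0" by simp
      then show ?thesis using p by simp
    next
      case False
      then obtain m where m: "n = Suc (Suc m)" by (metis One_nat_def not_less_eq_eq not0_implies_Suc le_0_eq nat_le_linear)
      have "- bernstein_mean m d2 p = bernstein_mean m (\<lambda>j. - d2 j) p"
        by (simp add: bernstein_mean_def sum_negf)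
      also have "\<dots> \<le> bernstein_mean m (\<lambda>j. 1 / real (Suc j) + 1 / real (Suc (m - j))) p"
        using p unfolding d2_def c_def m
        by (intro bernstein_mean_mono ln_binomial_second_difference) auto
      \<comment> \<open>The failures m - J follow Bin(m, 1 - p), so one bound on the mean of 1 / (J
        + 1) serves both halves.\<close>
      also have "\<dots> = bernstein_mean m (\<lambda>j. 1 / real (Suc j)) p
          + bernstein_mean m (\<lambda>j. 1 / real (Suc j)) (1 - p)"
        unfolding bernstein_mean_reflect by (simp add: bernstein_mean_def sum.distrib algebra_simps)
      finally have "real (Suc m) * - bernstein_mean m d2 p
          \<le> real (Suc m) * (bernstein_mean m (\<lambda>j. 1 / real (Suc j)) p
          + bernstein_mean m (\<lambda>j. 1 / real (Suc j)) (1 - p))"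
        by (rule mult_left_mono) simp
      also have "\<dots> \<le> 1 / p + 1 / (1 - p)"
        using bernstein_mean_inverse_Suc[of p m] bernstein_mean_inverse_Suc[of "1 - p" m] p
        unfolding distrib_left by linarith
      finally show ?thesis by (simp add: m)
    qed
    then have "real n * - (real (n - 1) * bernstein_mean (n - 2) d2 p)
        \<le> real n * (1 / p + 1 / (1 - p))"
      by (rule mult_left_mono) simp
    then show "G'' p \<le> 0"
      by (simp add: G''_def)
  qed
  moreover have "G p = binomial_entropy n p" if "p \<in> {0<..<1}" for p
    using that by (simp add: G_def c_def[abs_def] binomial_entropy_eq)
  ultimately show ?thesis
    by (auto simp: concave_on_iff convexD)
       (smt (verit, best) add_strict_increasing convex_bound_lt greaterThanLessThan_iff mult_eq_0_iff mult_nonneg_nonneg)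
qed

lemma Bernstein_le_1:
  assumes "0 \<le> p" "p \<le> 1"
  shows "Bernstein n j p \<le> 1"
proof (cases "j \<le> n")
  case True
  then have "Bernstein n j p \<le> (\<Sum>j\<le>n. Bernstein n j p)"
    using assms by (intro member_le_sum Bernstein_nonneg) auto
  then show ?thesis by simp
next
  case False
  then show ?thesis by (simp add: Bernstein_def binomial_eq_0)
qed

lemma binomial_entropy_nonneg:
  assumes "0 \<le> p" "p \<le> 1"
  shows "0 \<le> binomial_entropy n p"
proof -
  have "Bernstein n j p * ln (Bernstein n j p) \<le> 0" for j
    using Bernstein_nonneg[OF assms, of n j] Bernstein_le_1[OF assms, of n j]
    by (cases "Bernstein n j p = 0") (auto intro!: mult_nonneg_nonpos)
  then show ?thesis
    unfolding binomial_entropy_def by (simp add: sum_nonpos)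
qed

lemma binomial_entropy_le_half:
  assumes "0 \<le> p" "p \<le> 1"
  shows "binomial_entropy n p \<le> binomial_entropy n (1/2)"
\<comment> \<open>Concavity is available on the open interval only; at the ends the law is
  degenerate and its entropy is 0.\<close>
proof (cases "p = 0 \<or> p = 1")
  case True
  have "Bernstein n j 0 * ln (Bernstein n j 0) = 0" for j
    by (cases j) (auto simp: Bernstein_def)
  then have "binomial_entropy n 0 = 0"
    by (simp only: binomial_entropy_def sum.neutral_const minus_zero)
  then have "binomial_entropy n p = 0"
    using True binomial_entropy_reflect[of n 0] by auto
  then show ?thesis using binomial_entropy_nonneg[of "1/2" n] by simp
next
  case False
  then have p: "p \<in> {0<..<1}" "1 - p \<in> {0<..<1}" using assms by auto
  from concave_onD[OF binomial_entropy_concave _ _ p, of "1/2" n]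
  show ?thesis by (simp add: binomial_entropy_reflect field_simps)
qed

lemma shannon_entropy_binomial_pmf:
  assumes "0 \<le> p" "p \<le> 1"
  shows "shannon_entropy (binomial_pmf n p) = binomial_entropy n p / ln 2"
proof -
  have pmf: "pmf (binomial_pmf n p) j = Bernstein n j p" for j
    using assms by (simp add: Bernstein_def)
  have fin: "finite (set_pmf (binomial_pmf n p))"
    using assms by auto
  have "(\<Sum>\<^sub>\<infinity>x\<in>set_pmf (binomial_pmf n p). pmf (binomial_pmf n p) x * log 2 (pmf (binomial_pmf n p) x))
      = (\<Sum>x\<in>set_pmf (binomial_pmf n p). pmf (binomial_pmf n p) x * log 2 (pmf (binomial_pmf n p) x))"
    by (rule infsum_finite[OF fin])
  also have "\<dots> = (\<Sum>x\<le>n. pmf (binomial_pmf n p) x * log 2 (pmf (binomial_pmf n p) x))"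
    using assms by (intro sum.mono_neutral_left)
      (auto simp: set_pmf_binomial_eq set_pmf_iff split: if_splits)
  finally show ?thesis
    unfolding shannon_entropy_def pmf binomial_entropy_def by (simp add: log_def sum_divide_distrib)
qed

section \<open>The law of the targets and of one answer\<close>

lemma borel_measurable_vec:
  fixes f :: "'a \<Rightarrow> real ^ 'k"
  assumes "\<And>i. (\<lambda>x. f x $ i) \<in> borel_measurable M"
  shows "f \<in> borel_measurable M"
  using assms by (subst borel_measurable_euclidean_space) (auto simp: Basis_vec_def inner_axis)

section \<open>Product densities on the space of target configurations\<close>

lemma measurable_vec_lambda: "vec_lambda \<in> PiM UNIV (\<lambda>_::'k::finite. borel) \<rightarrow>\<^sub>M (borel :: (real ^ 'k) measure)"
  by (rule borel_measurable_vec) simp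

text \<open>Independence produces a product measure on functions, whereas densities on
  \<open>real ^ 'k\<close> refer to \<open>lborel\<close>; this identity connects the two. Lebesgue
  measure is determined by the volumes of boxes, which are products of side lengths on both
  sides.\<close>

lemma lborel_vec: "(lborel :: (real ^ 'k) measure) = distr (PiM UNIV (\<lambda>_. lborel)) borel vec_lambda"
proof (rule lborel_eqI)
  interpret product_sigma_finite "\<lambda>_::'k. lborel :: real measure" ..
  have [measurable]: "vec_lambda \<in> PiM UNIV (\<lambda>_::'k. lborel) \<rightarrow>\<^sub>M (borel :: (real ^ 'k) measure)"
    by (rule borel_measurable_vec) simp
  fix l u :: "real ^ 'k"
  assume le: "\<And>b. b \<in> Basis \<Longrightarrow> l \<bullet> b \<le> u \<bullet> b"
  have le': "l $ i \<le> u $ i" for i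
    using le[of "axis i 1"] by (simp add: inner_axis axis_in_Basis_iff)
  have "emeasure (distr (PiM UNIV (\<lambda>_. lborel)) borel vec_lambda) (box l u)
      = emeasure (PiM UNIV (\<lambda>_::'k. lborel)) (PiE UNIV (\<lambda>i. {l $ i <..< u $ i}))"
    by (subst emeasure_distr) (auto intro!: arg_cong2[of _ _ _ _ emeasure] simp: space_PiM mem_box_cart PiE_iff)
  also have "\<dots> = (\<Prod>i\<in>UNIV. ennreal (u $ i - l $ i))"
    using le' by (subst emeasure_PiM) auto
  also have "\<dots> = ennreal (\<Prod>i\<in>UNIV. u $ i - l $ i)"
    using le' by (intro prod_ennreal) simp
  also have "(\<Prod>i\<in>UNIV. u $ i - l $ i) = (\<Prod>b\<in>Basis. (u - l) \<bullet> b)"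
    unfolding Basis_vec_def
    by (subst prod.UNION_disjoint) (auto simp: inner_axis axis_eq_axis)
  finally show "emeasure (distr (PiM UNIV (\<lambda>_. lborel)) borel vec_lambda) (box l u)
      = (\<Prod>b\<in>Basis. (u - l) \<bullet> b)" .
qed simp

text \<open>A product measure is determined by its values on rectangles, and there the integral of
  the product density factorises.\<close>

lemma PiM_density:
  fixes f :: "real \<Rightarrow> real"
  assumes [measurable]: "f \<in> borel_measurable borel" and "\<And>x. 0 \<le> f x"
    and "prob_space (density lborel f)"
  shows "PiM (UNIV :: 'k::finite set) (\<lambda>_. density lborel f)
     = density (PiM UNIV (\<lambda>_. lborel)) (\<lambda>x. \<Prod>i\<in>UNIV. f (x i))"
proof -
  interpret L: product_sigma_finite "\<lambda>_::'k. lborel :: real measure" ..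
  interpret D: prob_space "density lborel f" by fact
  interpret D: product_sigma_finite "\<lambda>_::'k. density lborel f" ..
  show ?thesis
  proof (rule D.PiM_eqI[symmetric])
    show "sets (density (PiM UNIV (\<lambda>_. lborel)) (\<lambda>x. \<Prod>i\<in>UNIV. f (x i)))
        = sets (PiM (UNIV :: 'k set) (\<lambda>_. density lborel f))"
      by (simp cong: sets_PiM_cong)
    fix A :: "'k \<Rightarrow> real set"
    assume "\<And>i. i \<in> UNIV \<Longrightarrow> A i \<in> sets (density lborel f)"
    then have [measurable]: "A i \<in> sets borel" for i by simp
    have "emeasure (density (PiM UNIV (\<lambda>_. lborel)) (\<lambda>x. \<Prod>i\<in>UNIV. f (x i))) (PiE UNIV A)
        = (\<integral>\<^sup>+x. ennreal (\<Prod>i\<in>UNIV. f (x i)) * indicator (PiE UNIV A) x \<partial>PiM UNIV (\<lambda>_. lborel))"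
      by (subst emeasure_density) (auto intro!: sets_PiM_I_finite)
    also have "\<dots> = (\<integral>\<^sup>+x. (\<Prod>i\<in>UNIV. ennreal (f (x i)) * indicator (A i) (x i)) \<partial>PiM UNIV (\<lambda>_. lborel))"
    proof (rule nn_integral_cong)
      fix x :: "'k \<Rightarrow> real"
      have "ennreal (\<Prod>i\<in>UNIV. f (x i)) = (\<Prod>i\<in>UNIV. ennreal (f (x i)))"
        using assms(2) by (simp add: prod_ennreal)
      moreover have "(indicator (PiE UNIV A) x :: ennreal) = (\<Prod>i\<in>UNIV. indicator (A i) (x i))"
        by (cases "\<forall>i. x i \<in> A i") (auto simp: indicator_def PiE_iff)
      ultimately show "ennreal (\<Prod>i\<in>UNIV. f (x i)) * indicator (PiE UNIV A) x
          = (\<Prod>i\<in>UNIV. ennreal (f (x i)) * indicator (A i) (x i))"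
        by (simp add: prod.distrib)
    qed
    also have "\<dots> = (\<Prod>i\<in>UNIV. (\<integral>\<^sup>+x. ennreal (f x) * indicator (A i) x \<partial>lborel))"
      by (rule L.product_nn_integral_prod) auto
    also have "\<dots> = (\<Prod>i\<in>UNIV. emeasure (density lborel f) (A i))"
      by (intro prod.cong refl) (simp add: emeasure_density)
    finally show "emeasure (density (PiM UNIV (\<lambda>_. lborel)) (\<lambda>x. \<Prod>i\<in>UNIV. f (x i))) (PiE UNIV A)
        = (\<Prod>i\<in>UNIV. emeasure (density lborel f) (A i))" .
  qed simp
qed

lemma (in prob_space) distr_iid_density:
  fixes X :: "'a \<Rightarrow> real ^ 'k"
  assumes f: "\<And>x. 0 \<le> f x"
    and distributed: "\<And>i. distributed M lborel (\<lambda>\<omega>. X \<omega> $ i) (\<lambda>x. ennreal (f x))"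
    and indep: "indep_vars (\<lambda>_. borel) (\<lambda>i \<omega>. X \<omega> $ i) UNIV"
  shows "distr M borel X = density lborel (iid_density f)"
proof -
  have X [measurable]: "(\<lambda>\<omega>. X \<omega> $ i) \<in> borel_measurable M" for i
    using distributed_measurable[OF distributed[of i]] by simp
  \<comment> \<open>Here \<open>undefined\<close> just picks some coordinate; all of them have
    density \<open>f\<close>.\<close>
  have f_meas [measurable]: "f \<in> borel_measurable borel"
    by (rule distributed_real_measurable[OF f distributed[of undefined], simplified])
  have law: "distr M borel (\<lambda>\<omega>. X \<omega> $ i) = density lborel f" for i
    using distributed_distr_eq_density[OF distributed[of i]]
    by (simp cong: distr_cong)
  have prob: "prob_space (density lborel f)"
    using prob_space_distr[OF X[of undefined]] law[of undefined] by simp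
  have joint: "distr M (PiM UNIV (\<lambda>_. borel)) (\<lambda>\<omega>. \<lambda>i\<in>UNIV. X \<omega> $ i) = PiM UNIV (\<lambda>_::'k. density lborel f)"
    using indep by (subst (asm) indep_vars_iff_distr_eq_PiM) (auto simp: law)
  have "distr M borel X
      = distr (distr M (PiM UNIV (\<lambda>_. borel)) (\<lambda>\<omega>. \<lambda>i\<in>UNIV. X \<omega> $ i)) borel vec_lambda"
    by (subst distr_distr[OF measurable_vec_lambda]) (auto simp: comp_def restrict_UNIV intro!: measurable_PiM_single' X)
  also have "\<dots> = distr (density (PiM UNIV (\<lambda>_. lborel)) (\<lambda>x. \<Prod>i\<in>UNIV. f (x i))) borel vec_lambda"
    by (simp add: joint PiM_density f prob)
  also have "\<dots> = density lborel (iid_density f)"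
    unfolding lborel_vec iid_density_def
    by (subst density_distr) (auto intro!: borel_measurable_vec)
  finally show ?thesis .
qed

section \<open>Binomial law of the number of targets in a fixed set\<close>

lemma target_count_eq_card: "target_count A u = card {i. u $ i \<in> A}"
  unfolding target_count_def by (simp add: indicator_def sum.If_cases)

text \<open>Split the event by the exact set S of coordinates that fall into A. These events are
  disjoint, independence gives each the probability p^j (1 - p)^(k - j), and there are (k choose j)
  sets S of size j.\<close>

lemma (in prob_space) prob_target_count:
  fixes X :: "'a \<Rightarrow> real ^ 'k"
  assumes indep: "indep_vars (\<lambda>_. borel) (\<lambda>i \<omega>. X \<omega> $ i) UNIV"
    and A [measurable]: "A \<in> sets borel"
    and p: "\<And>i. prob {\<omega> \<in> space M. X \<omega> $ i \<in> A} = p"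
  shows "prob {\<omega> \<in> space M. target_count A (X \<omega>) = j} = Bernstein CARD('k) j p"
proof -
  have X [measurable]: "(\<lambda>\<omega>. X \<omega> $ i) \<in> borel_measurable M" for i
    using indep by (auto simp: indep_vars_def)
  define E where "E S = {\<omega> \<in> space M. {i. X \<omega> $ i \<in> A} = S}" for S
  have E_eq: "E S = (\<Inter>i\<in>UNIV. (\<lambda>\<omega>. X \<omega> $ i) -` (if i \<in> S then A else - A) \<inter> space M)" for S
    by (auto simp: E_def split: if_splits)
  have E_events: "E S \<in> events" for S
    unfolding E_eq by (intro sets.finite_INT) (auto intro!: measurable_sets[OF X])
  have compl: "prob {\<omega> \<in> space M. X \<omega> $ i \<in> - A} = 1 - p" for i
    using prob_compl[of "{\<omega> \<in> space M. X \<omega> $ i \<in> A}"] p[of i]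
    by (simp add: set_diff_eq Collect_conj_eq[symmetric] conj_commute cong: conj_cong)
  have prob_E: "prob (E S) = p ^ card S * (1 - p) ^ (CARD('k) - card S)" for S :: "'k set"
  proof -
    have "prob (E S) = (\<Prod>i\<in>UNIV. prob ((\<lambda>\<omega>. X \<omega> $ i) -` (if i \<in> S then A else - A) \<inter> space M))"
      unfolding E_eq by (rule indep_varsD[OF indep]) auto
    also have "\<dots> = (\<Prod>i\<in>UNIV. if i \<in> S then p else 1 - p)"
      using p compl by (intro prod.cong refl) (auto simp: vimage_def Int_def conj_commute)
    also have "\<dots> = p ^ card S * (1 - p) ^ card (- S)"
      by (simp add: prod.If_cases)
    finally show ?thesis by (simp add: Compl_eq_Diff_UNIV card_Diff_subset)
  qed
  have "{\<omega> \<in> space M. target_count A (X \<omega>) = j} = (\<Union>S\<in>{S. card S = j}. E S)"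
    by (auto simp: target_count_eq_card E_def)
  then have "prob {\<omega> \<in> space M. target_count A (X \<omega>) = j} = (\<Sum>S\<in>{S. card S = j}. prob (E S))"
    using E_events by (auto simp: disjoint_family_on_def E_def intro!: finite_measure_finite_Union)
  also have "\<dots> = (\<Sum>S\<in>{S::'k set. card S = j}. p ^ j * (1 - p) ^ (CARD('k) - j))"
    by (intro sum.cong) (auto simp: prob_E)
  also have "\<dots> = Bernstein CARD('k) j p"
    using n_subsets[of "UNIV :: 'k set" j] by (simp add: Bernstein_def)
  finally show ?thesis .
qed

section \<open>Entropy of a conditioned density\<close>

text \<open>Only the fibres of \<open>X\<close> have to be events, so \<open>X\<close> may take
  values in a type without a \<sigma>-algebra, such as the functions that encode answer
  vectors.\<close>

lemma (in prob_space) expectation_finite_range: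
  fixes g :: "'b \<Rightarrow> real"
  assumes "finite S" "\<And>\<omega>. \<omega> \<in> space M \<Longrightarrow> X \<omega> \<in> S"
    and "\<And>x. x \<in> S \<Longrightarrow> {\<omega> \<in> space M. X \<omega> = x} \<in> events"
  shows "integrable M (\<lambda>\<omega>. g (X \<omega>))"
    and "expectation (\<lambda>\<omega>. g (X \<omega>)) = (\<Sum>x\<in>S. prob {\<omega> \<in> space M. X \<omega> = x} * g x)"
proof -
  have eq: "g (X \<omega>) = (\<Sum>x\<in>S. indicator {\<omega> \<in> space M. X \<omega> = x} \<omega> * g x)" if "\<omega> \<in> space M" for \<omega>
  proof -
    have "(\<Sum>x\<in>S. indicator {\<omega> \<in> space M. X \<omega> = x} \<omega> * g x) = (\<Sum>x\<in>S. if x = X \<omega> then g x else 0)"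
      using that by (intro sum.cong) (auto simp: indicator_def)
    with assms that show ?thesis by (simp add: sum.delta)
  qed
  have int: "integrable M (\<lambda>\<omega>. indicator {\<omega> \<in> space M. X \<omega> = x} \<omega> * g x)" if "x \<in> S" for x
    using assms(3)[OF that] by (simp add: less_top[symmetric])
  show "integrable M (\<lambda>\<omega>. g (X \<omega>))"
    using int by (subst Bochner_Integration.integrable_cong[OF refl eq]) auto
  have "expectation (\<lambda>\<omega>. g (X \<omega>)) = (\<Sum>x\<in>S. expectation (\<lambda>\<omega>. indicator {\<omega> \<in> space M. X \<omega> = x} \<omega> * g x))"
    using int by (subst Bochner_Integration.integral_cong[OF refl eq]) auto
  also have "\<dots> = (\<Sum>x\<in>S. prob {\<omega> \<in> space M. X \<omega> = x} * g x)"
    using assms(3) by (intro sum.cong refl) (simp add: Int_absorb1 subset_eq)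
  finally show "expectation (\<lambda>\<omega>. g (X \<omega>)) = \<dots>" .
qed

text \<open>Gibbs' inequality against the product of the marginals.\<close>

lemma (in prob_space) joint_entropy_le_sum_entropies:
  fixes T :: "'b \<Rightarrow> 'a \<Rightarrow> nat" and k :: nat
  assumes I: "finite I" and T [measurable]: "\<And>m. m \<in> I \<Longrightarrow> T m \<in> M \<rightarrow>\<^sub>M count_space UNIV"
    and T_le: "\<And>m \<omega>. m \<in> I \<Longrightarrow> \<omega> \<in> space M \<Longrightarrow> T m \<omega> \<le> k"
  defines "b m j \<equiv> prob {\<omega> \<in> space M. T m \<omega> = j}"
    and "Q x \<equiv> prob {\<omega> \<in> space M. (\<lambda>m\<in>I. T m \<omega>) = x}"
  shows "- (\<Sum>x\<in>PiE I (\<lambda>_. {..k}). Q x * ln (Q x)) \<le> (\<Sum>m\<in>I. - (\<Sum>j\<le>k. b m j * ln (b m j)))"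
proof -
  define S where "S = PiE I (\<lambda>_. {..k})"
  define R where "R x = (\<Prod>m\<in>I. b m (x m))" for x
  have finS: "finite S" using I by (simp add: S_def finite_PiE)
  have X_S: "(\<lambda>m\<in>I. T m \<omega>) \<in> S" if "\<omega> \<in> space M" for \<omega>
    using T_le that by (auto simp: S_def)
  have X_events: "{\<omega> \<in> space M. (\<lambda>m\<in>I. T m \<omega>) = x} \<in> events" if "x \<in> S" for x
  proof -
    have "{\<omega> \<in> space M. (\<lambda>m\<in>I. T m \<omega>) = x} = {\<omega> \<in> space M. \<forall>m\<in>I. T m \<omega> = x m}"
      using that by (auto simp: S_def fun_eq_iff PiE_iff extensional_def)
    also have "\<dots> \<in> events" using I by measurable
    finally show ?thesis .
  qed
  note expect = expectation_finite_range[OF finS X_S X_events, folded Q_def]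
  have sumQ: "(\<Sum>x\<in>S. Q x) = 1"
    using expect(2)[of "\<lambda>_. 1"] by (simp add: prob_space)
  \<comment> \<open>Hence wherever Q x > 0, all marginals in the logarithms of the Gibbs step are
    positive.\<close>
  have Q_le: "Q x \<le> b m (x m)" if "m \<in> I" for x m
    unfolding Q_def b_def using that by (intro finite_measure_mono) auto
  have marginal: "(\<Sum>x\<in>S. Q x * g (x m)) = (\<Sum>j\<le>k. b m j * g j)" if "m \<in> I" for m and g :: "nat \<Rightarrow> real"
  proof -
    have "(\<Sum>x\<in>S. Q x * g (x m)) = expectation (\<lambda>\<omega>. g ((\<lambda>m\<in>I. T m \<omega>) m))"
      by (rule expect(2)[symmetric])
    also have "\<dots> = expectation (\<lambda>\<omega>. g (T m \<omega>))"
      using that by simp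
    also have "\<dots> = (\<Sum>j\<le>k. b m j * g j)"
      unfolding b_def using T_le[OF that] T[OF that] by (intro expectation_finite_range) auto
    finally show ?thesis .
  qed
  have "(\<Sum>x\<in>S. R x) = (\<Prod>m\<in>I. \<Sum>j\<le>k. b m j)"
    unfolding S_def R_def using I by (subst prod_sum_PiE) auto
  also have "\<dots> = 1"
    using marginal[of _ "\<lambda>_. 1"] sumQ by (intro prod.neutral) auto
  finally have sumR: "(\<Sum>x\<in>S. R x) = 1" .
  \<comment> \<open>This is ln t \<le> t - 1 at t = R x / Q x, multiplied by Q x. The right sides
    sum to 1 - 1 = 0.\<close>
  have gibbs: "Q x * (\<Sum>m\<in>I. ln (b m (x m))) - Q x * ln (Q x) \<le> R x - Q x" for x
  proof (cases "Q x = 0")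
    case True
    then show ?thesis by (simp add: R_def b_def prod_nonneg)
  next
    case False
    then have Q: "Q x > 0" by (simp add: Q_def zero_less_measure_iff)
    then have b: "b m (x m) > 0" if "m \<in> I" for m
      using Q_le[OF that, of x] by linarith
    then have R: "R x > 0" by (simp add: R_def prod_pos)
    have "(\<Sum>m\<in>I. ln (b m (x m))) - ln (Q x) = ln (R x / Q x)"
      using b Q R ln_prod[OF I, of "\<lambda>m. b m (x m)"] by (simp add: R_def ln_div less_imp_neq[THEN not_sym])
    also have "\<dots> \<le> R x / Q x - 1"
      using Q R by (intro ln_le_minus_one) simp
    finally have "Q x * ((\<Sum>m\<in>I. ln (b m (x m))) - ln (Q x)) \<le> Q x * (R x / Q x - 1)"
      using Q by (intro mult_left_mono) auto
    then show ?thesis using Q by (simp add: algebra_simps)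
  qed
  have "(\<Sum>m\<in>I. \<Sum>j\<le>k. b m j * ln (b m j)) - (\<Sum>x\<in>S. Q x * ln (Q x))
      = (\<Sum>m\<in>I. \<Sum>x\<in>S. Q x * ln (b m (x m))) - (\<Sum>x\<in>S. Q x * ln (Q x))"
    by (simp add: marginal[of _ "\<lambda>j. ln (b _ j)"])
  also have "\<dots> = (\<Sum>x\<in>S. Q x * (\<Sum>m\<in>I. ln (b m (x m))) - Q x * ln (Q x))"
    by (subst sum.swap) (simp add: sum_distrib_left sum_subtractf)
  also have "\<dots> \<le> (\<Sum>x\<in>S. R x - Q x)"
    by (intro sum_mono gibbs)
  also have "\<dots> = 0" by (simp add: sum_subtractf sumQ sumR)
  finally show ?thesis by (simp add: S_def sum_negf)
qed

section \<open>Differential entropy on the cells of a finite partition\<close>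

text \<open>Where p > 0 on C, log (p / Q) = log p - log Q; elsewhere the integrand is 0. For a null
  cell both sides are 0, because x / 0 = 0 and \<open>log 2 0 = 0\<close>.\<close>

lemma differential_entropy_conditioned:
  fixes p :: "real ^ 'k \<Rightarrow> real"
  assumes p: "\<And>u. 0 \<le> p u" "integrable lborel p"
    and int: "integrable lborel (\<lambda>u. p u * log 2 (p u))"
    and C: "C \<in> sets borel"
  defines "Q \<equiv> (\<integral>w. indicator C w * p w \<partial>lborel)"
  shows "differential_entropy (\<lambda>v. indicator C v * p v / Q)
    = log 2 Q - (\<integral>v. indicator C v * (p v * log 2 (p v)) \<partial>lborel) / Q"
proof (cases "Q = 0")
  case False
  have "Q \<ge> 0" unfolding Q_def using p(1) by (intro integral_nonneg_AE) auto
  with False have Q: "Q > 0" by simp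
  have i1: "integrable lborel (\<lambda>v. indicator C v * (p v * log 2 (p v)))"
    using integrable_mult_indicator[OF _ int, of C] C by simp
  have i2: "integrable lborel (\<lambda>v. indicator C v * p v)"
    using integrable_mult_indicator[OF _ p(2), of C] C by simp
  have "indicator C v * p v / Q * log 2 (indicator C v * p v / Q)
      = indicator C v * (p v * log 2 (p v)) / Q - indicator C v * p v * (log 2 Q / Q)" for v
    using Q p(1)[of v] by (cases "p v = 0") (auto simp: indicator_def log_divide field_simps)
  then have "differential_entropy (\<lambda>v. indicator C v * p v / Q)
      = - ((\<integral>v. indicator C v * (p v * log 2 (p v)) \<partial>lborel) / Q - Q * (log 2 Q / Q))"
    unfolding differential_entropy_def using i1 i2 by (simp add: Q_def)
  then show ?thesis using Q by simp
qed (simp add: differential_entropy_def log_def)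

lemma measure_density_lborel:
  fixes p :: "'b::euclidean_space \<Rightarrow> real"
  assumes p: "\<And>u. 0 \<le> p u" "integrable lborel p" and C: "C \<in> sets borel"
  shows "measure (density lborel p) C = (\<integral>w. indicator C w * p w \<partial>lborel)"
proof -
  have "measure (density lborel p) C = (\<integral>w. indicator C w \<partial>density lborel p)"
    using C by simp
  also have "\<dots> = (\<integral>w. indicator C w * p w \<partial>lborel)"
    using p C by (subst integral_real_density) (auto simp: mult.commute)
  finally show ?thesis .
qed

text \<open>The posterior depends on u only through X u, so \<open>h\<close> has finitely many
  values and its mean is a sum over cells. The integrals of p log p over the cells add up to minus
  the prior entropy, and what remains is the entropy of X. The bound on the absolute value is meant
  for Fubini.\<close>

lemma expected_conditioned_entropy:
  fixes p :: "real ^ 'k \<Rightarrow> real"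
  assumes p: "\<And>u. 0 \<le> p u" "integrable lborel p"
    and int: "integrable lborel (\<lambda>u. p u * log 2 (p u))"
    and prob: "prob_space (density lborel p)"
    and S: "finite S" "\<And>u. X u \<in> S" "\<And>x. x \<in> S \<Longrightarrow> {u. X u = x} \<in> sets borel"
  defines "Q x \<equiv> measure (density lborel p) {u. X u = x}"
    and "h u \<equiv> differential_entropy (\<lambda>v. indicator {v. X v = X u} v * p v
                  / (\<integral>w. indicator {v. X v = X u} w * p w \<partial>lborel))"
  shows "integrable (density lborel p) h"
    and "(\<integral>u. h u \<partial>density lborel p) = differential_entropy p + (\<Sum>x\<in>S. Q x * log 2 (Q x))"
    and "(\<integral>u. \<bar>h u\<bar> \<partial>density lborel p)
        \<le> (\<integral>u. \<bar>p u * log 2 (p u)\<bar> \<partial>lborel) - (\<Sum>x\<in>S. Q x * log 2 (Q x))"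
proof -
  interpret prob_space "density lborel p" by fact
  let ?l = "\<lambda>u. p u * log 2 (p u)"
  define C where "C x = {u. X u = x}" for x
  define L where "L x = (\<integral>v. indicator (C x) v * ?l v \<partial>lborel)" for x
  define g where "g x = log 2 (Q x) - L x / Q x" for x
  have C: "C x \<in> sets borel" if "x \<in> S" for x using S(3)[OF that] by (simp add: C_def)
  have Q_eq: "Q x = (\<integral>w. indicator (C x) w * p w \<partial>lborel)" if "x \<in> S" for x
    unfolding Q_def C_def[symmetric] using p C[OF that] by (rule measure_density_lborel)
  have h: "h u = g (X u)" for u
    using differential_entropy_conditioned[OF p int C[OF S(2)[of u]]] Q_eq[OF S(2)[of u]]
    by (simp add: h_def g_def L_def C_def)
  have space: "space (density lborel p) = UNIV" by simp
  have S3: "{u \<in> space (density lborel p). X u = x} \<in> events" if "x \<in> S" for x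
    using S(3)[OF that] by simp
  note expect = expectation_finite_range[of S X, OF S(1,2) S3, unfolded space, simplified, folded Q_def]
  show "integrable (density lborel p) h"
    unfolding h by (rule expect(1))
  have part: "(\<Sum>x\<in>S. indicator (C x) u * c) = (c :: real)" for u c
  proof -
    have "(\<Sum>x\<in>S. indicator (C x) u * c) = (\<Sum>x\<in>S. if x = X u then c else 0)"
      by (intro sum.cong) (auto simp: indicator_def C_def)
    with S(1,2) show ?thesis by simp
  qed
  have intC: "integrable lborel (\<lambda>v. indicator (C x) v * ?l v)" if "x \<in> S" for x
    using integrable_mult_indicator[OF _ int, of "C x"] C[OF that] by simp
  have intC': "integrable lborel (\<lambda>v. indicator (C x) v * \<bar>?l v\<bar>)" if "x \<in> S" for x
    using integrable_mult_indicator[OF _ integrable_abs[OF int], of "C x"] C[OF that] by simp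
  have sumL: "(\<Sum>x\<in>S. L x) = (\<integral>u. ?l u \<partial>lborel)"
    unfolding L_def using intC by (subst Bochner_Integration.integral_sum[symmetric]) (auto simp: part)
  have sumL': "(\<Sum>x\<in>S. \<bar>L x\<bar>) \<le> (\<integral>u. \<bar>?l u\<bar> \<partial>lborel)"
  proof -
    have "(\<Sum>x\<in>S. \<bar>L x\<bar>) \<le> (\<Sum>x\<in>S. \<integral>v. indicator (C x) v * \<bar>?l v\<bar> \<partial>lborel)"
    proof (rule sum_mono)
      fix x assume "x \<in> S"
      have "\<bar>L x\<bar> \<le> (\<integral>v. \<bar>indicator (C x) v * ?l v\<bar> \<partial>lborel)"
        unfolding L_def by (rule integral_abs_bound)
      then show "\<bar>L x\<bar> \<le> (\<integral>v. indicator (C x) v * \<bar>?l v\<bar> \<partial>lborel)"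
        by (simp add: abs_mult)
    qed
    also have "\<dots> = (\<integral>u. \<bar>?l u\<bar> \<partial>lborel)"
      using intC' by (subst Bochner_Integration.integral_sum[symmetric]) (auto simp: part)
    finally show ?thesis .
  qed
  have Q01: "0 \<le> Q x" "Q x \<le> 1" for x by (auto simp: Q_def)
  \<comment> \<open>On a cell of probability 0 the density vanishes almost everywhere. So the
    formula for Q x * g x survives the division by zero in \<open>g\<close>.\<close>
  have L0: "L x = 0" if "x \<in> S" "Q x = 0" for x
  proof -
    have "integrable lborel (\<lambda>v. indicator (C x) v * p v)"
      using integrable_mult_indicator[OF _ p(2), of "C x"] C[OF that(1)] by simp
    then have "AE v in lborel. indicator (C x) v * p v = 0"
      using that Q_eq[OF that(1)] p(1) by (subst integral_nonneg_eq_0_iff_AE[symmetric]) auto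
    then have "AE v in lborel. indicator (C x) v * ?l v = 0"
      by eventually_elim (metis mult.assoc mult_zero_left)
    then show ?thesis unfolding L_def by (rule integral_eq_zero_AE)
  qed
  have Qg: "Q x * g x = Q x * log 2 (Q x) - L x" if "x \<in> S" for x
    using L0[OF that] by (cases "Q x = 0") (auto simp: g_def field_simps)
  have "(\<integral>u. h u \<partial>density lborel p) = (\<Sum>x\<in>S. Q x * g x)"
    unfolding h by (rule expect(2))
  also have "\<dots> = (\<Sum>x\<in>S. Q x * log 2 (Q x)) - (\<Sum>x\<in>S. L x)"
    by (simp add: Qg sum_subtractf)
  finally show "(\<integral>u. h u \<partial>density lborel p) = differential_entropy p + (\<Sum>x\<in>S. Q x * log 2 (Q x))"
    by (simp add: sumL differential_entropy_def)
  have "(\<integral>u. \<bar>h u\<bar> \<partial>density lborel p) = (\<Sum>x\<in>S. Q x * \<bar>g x\<bar>)"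
    unfolding h by (rule expect(2))
  also have "\<dots> \<le> (\<Sum>x\<in>S. \<bar>L x\<bar> - Q x * log 2 (Q x))"
  proof (rule sum_mono)
    fix x assume x: "x \<in> S"
    have "Q x * \<bar>g x\<bar> = \<bar>Q x * g x\<bar>" using Q01(1)[of x] by (simp add: abs_mult)
    also have "\<dots> \<le> \<bar>L x\<bar> + \<bar>Q x * log 2 (Q x)\<bar>" unfolding Qg[OF x] by linarith
    also have "\<bar>Q x * log 2 (Q x)\<bar> = - (Q x * log 2 (Q x))"
      using Q01[of x] by (cases "Q x = 0") (auto intro!: abs_of_nonpos mult_nonneg_nonpos)
    finally show "Q x * \<bar>g x\<bar> \<le> \<bar>L x\<bar> - Q x * log 2 (Q x)" by simp
  qed
  finally show "(\<integral>u. \<bar>h u\<bar> \<partial>density lborel p)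
        \<le> (\<integral>u. \<bar>?l u\<bar> \<partial>lborel) - (\<Sum>x\<in>S. Q x * log 2 (Q x))"
    using sumL' by (simp add: sum_subtractf)
qed

section \<open>Non-adaptive policies\<close>

text \<open>The set being counted varies with x, but as a section of the fixed measurable set
  \<open>S\<close>: coordinate i is counted iff the pair (f x, g x $ i) lies in
  \<open>S\<close>.\<close>

lemma measurable_target_count:
  assumes S: "S \<in> sets (N \<Otimes>\<^sub>M borel)"
    and f [measurable]: "f \<in> M \<rightarrow>\<^sub>M N" and g [measurable]: "g \<in> M \<rightarrow>\<^sub>M (borel :: (real ^ 'k) measure)"
  shows "(\<lambda>x. target_count {t. (f x, t) \<in> S} (g x)) \<in> M \<rightarrow>\<^sub>M count_space UNIV"
  unfolding target_count_def
proof (rule measurable_sum_nat)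
  fix i :: 'k
  have [measurable]: "(\<lambda>x. g x $ i) \<in> borel_measurable M"
    by (rule measurable_compose[OF g borel_measurable_nth])
  have "(\<lambda>x. (f x, g x $ i)) \<in> M \<rightarrow>\<^sub>M N \<Otimes>\<^sub>M borel" by measurable
  from measurable_sets[OF this S]
  have [measurable]: "Measurable.pred M (\<lambda>x. (f x, g x $ i) \<in> S)"
    by (simp add: Measurable.pred_def vimage_def Int_def conj_commute)
  have "(\<lambda>x. indicator {t. (f x, t) \<in> S} (g x $ i) :: nat) = (\<lambda>x. if (f x, g x $ i) \<in> S then 1 else 0)"
    by (simp add: fun_eq_iff indicator_def)
  also have "\<dots> \<in> M \<rightarrow>\<^sub>M count_space UNIV" by measurable
  finally show "(\<lambda>x. indicator {t. (f x, t) \<in> S} (g x $ i) :: nat) \<in> M \<rightarrow>\<^sub>M count_space UNIV" .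
qed

lemma target_count_le: "target_count A (u :: real ^ 'k) \<le> CARD('k)"
  unfolding target_count_eq_card by (intro card_mono) auto

lemma sets_pair_measure_mono:
  assumes "sets A \<subseteq> sets A'" "sets B \<subseteq> sets B'"
  shows "sets (A \<Otimes>\<^sub>M B) \<subseteq> sets (A' \<Otimes>\<^sub>M B')"
  using assms unfolding sets_pair_measure[of A B]
  by (intro sets.sigma_sets_subset') (auto intro!: pair_measureI simp: subset_eq)

text \<open>Inserting a measurable answer history into a question leaves a measurable subset of
  [0,1] \<times> \<real>, the preimage of \<pi> n under (z, t) \<mapsto> (z, g z, t).\<close>

lemma policy_section_measurable:
  assumes "\<pi> \<in> policies k N" "n \<in> {1..N}"
    and g: "g \<in> restrict_space borel {0..1} \<rightarrow>\<^sub>M count_space {xs. length xs = n - 1 \<and> set xs \<subseteq> {0..k}}"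
  shows "{(z, t). (z, g z, t) \<in> \<pi> n} \<in> sets (restrict_space borel {0..1} \<Otimes>\<^sub>M borel)"
proof -
  have \<pi>: "\<pi> n \<in> sets (restrict_space borel {0..1} \<Otimes>\<^sub>M
      (count_space {xs. length xs = n - 1 \<and> set xs \<subseteq> {0..k}} \<Otimes>\<^sub>M borel))"
    using assms by (auto simp: policies_def)
  note [measurable] = g
  have "(\<lambda>x. (fst x, g (fst x), snd x)) \<in> restrict_space borel {0..1} \<Otimes>\<^sub>M borel \<rightarrow>\<^sub>M
      restrict_space borel {0..1} \<Otimes>\<^sub>M (count_space {xs. length xs = n - 1 \<and> set xs \<subseteq> {0..k}} \<Otimes>\<^sub>M borel)"
    by measurable
  note measurable_sets[OF this \<pi>]
  also have "(\<lambda>x. (fst x, g (fst x), snd x)) -` \<pi> n \<inter> space (restrict_space borel {0..1} \<Otimes>\<^sub>M borel)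
      = {(z, t). (z, g z, t) \<in> \<pi> n}"
    using sets.sets_into_space[OF \<pi>] by (force simp: space_pair_measure space_restrict_space)
  finally show ?thesis .
qed

lemma answers_measurable:
  fixes u :: "real ^ 'k"
  assumes "\<pi> \<in> policies CARD('k) N" "n \<le> N"
  shows "(\<lambda>z. answers \<pi> z u n) \<in> restrict_space borel {0..1} \<rightarrow>\<^sub>M
    count_space {xs. length xs = n \<and> set xs \<subseteq> {0..CARD('k)}}"
  using assms(2)
proof (induction n)
  case (Suc n)
  define c where "c z = target_count {t. (z, answers \<pi> z u n, t) \<in> \<pi> (Suc n)} u" for z
  from Suc have IH: "(\<lambda>z. answers \<pi> z u n) \<in> restrict_space borel {0..1} \<rightarrow>\<^sub>M
    count_space {xs. length xs = n \<and> set xs \<subseteq> {0..CARD('k)}}" by simp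
  from IH have IH': "(\<lambda>z. answers \<pi> z u n) \<in> restrict_space borel {0..1} \<rightarrow>\<^sub>M count_space UNIV"
    by (rule measurable_compose) simp
  have "{(z, t). (z, answers \<pi> z u n, t) \<in> \<pi> (Suc n)} \<in> sets (restrict_space borel {0..1} \<Otimes>\<^sub>M borel)"
    using Suc.prems IH by (intro policy_section_measurable[OF assms(1)]) auto
  from measurable_target_count[OF this measurable_ident_sets[OF refl] measurable_const, of u]
  have c: "c \<in> restrict_space borel {0..1} \<rightarrow>\<^sub>M count_space UNIV"
    by (simp add: c_def[abs_def])
  have "(\<lambda>z. answers \<pi> z u n @ [c z]) \<in> restrict_space borel {0..1} \<rightarrow>\<^sub>M count_space UNIV"
    using IH' by (rule measurable_compose_countable[rotated]) (rule measurable_compose[OF c], simp)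
  then have "(\<lambda>z. answers \<pi> z u (Suc n)) \<in> restrict_space borel {0..1} \<rightarrow>\<^sub>M count_space UNIV"
    by (simp add: c_def)
  \<comment> \<open>Policies are measurable over histories of the right length with entries at most
    k, so the codomain is narrowed from all lists to these.\<close>
  moreover have "(\<lambda>z. answers \<pi> z u (Suc n)) \<in> space (restrict_space borel {0..1})
      \<rightarrow> {xs. length xs = Suc n \<and> set xs \<subseteq> {0..CARD('k)}}"
    using measurable_space[OF IH] by (auto simp: target_count_le)
  ultimately show ?case
    by (rule measurable_count_space_extend[OF subset_UNIV, rotated])
qed simp

lemma restrict_eq_iff: "restrict f A = restrict g A \<longleftrightarrow> (\<forall>x\<in>A. f x = g x)"
  by (metis restrict_apply' restrict_ext)

lemma pred_eq_nat:
  fixes f g :: "'b \<Rightarrow> nat"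
  assumes [measurable]: "f \<in> M \<rightarrow>\<^sub>M count_space UNIV" "g \<in> M \<rightarrow>\<^sub>M count_space UNIV"
  shows "Measurable.pred M (\<lambda>x. f x = g x)"
  by (rule measurable_compose_countable[where f = "\<lambda>n x. n = g x" and g = f]) measurable

text \<open>Under a non-adaptive policy the questions do not depend on the configuration of the targets,
  so they are evaluated at the arbitrary configuration \<open>0\<close>.\<close>

definition answer_vector :: "policy \<Rightarrow> nat \<Rightarrow> real \<Rightarrow> real ^ 'k \<Rightarrow> nat \<Rightarrow> nat" where
  "answer_vector \<pi> N z u = (\<lambda>m\<in>{1..N}. target_count (question_set \<pi> z (0 :: real ^ 'k) m) u)"

section \<open>Questions and posterior entropy of a fixed non-adaptive policy\<close>

context
  fixes \<pi> :: policy and N :: nat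
  assumes \<pi>: "\<pi> \<in> non_adaptive_policies TYPE('k::finite) N"
begin

text \<open>Since [0,1] is Borel, the Borel subsets of [0,1] \<times> \<real> are Borel in the
  plane; the whole line then serves as the space for Z.\<close>

lemma question_set_sets:
  assumes "m \<in> {1..N}"
  shows "{(z, t). t \<in> question_set \<pi> z (0 :: real ^ 'k) m} \<in> sets (borel \<Otimes>\<^sub>M borel)"
proof -
  have "{(z, t). t \<in> question_set \<pi> z (0 :: real ^ 'k) m} = {(z, t). (z, answers \<pi> z (0 :: real ^ 'k) (m - 1), t) \<in> \<pi> m}"
    by (simp add: question_set_def)
  also have "\<dots> \<in> sets (restrict_space borel {0..1} \<Otimes>\<^sub>M borel)"
    using \<pi> assms
    by (intro policy_section_measurable[of _ "CARD('k)" N] answers_measurable[of _ N])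
       (auto simp: non_adaptive_policies_def)
  also have "\<dots> \<subseteq> sets (borel \<Otimes>\<^sub>M borel)"
    by (rule sets_pair_measure_mono) (auto simp: sets_restrict_space)
  finally show ?thesis .
qed

text \<open>Non-adaptivity speaks of z in [0,1]; for other z every question set is empty, because
  \<pi> m lies over [0,1].\<close>

lemma question_set_non_adaptive:
  assumes m: "m \<in> {1..N}"
  shows "question_set \<pi> z (u :: real ^ 'k) m = question_set \<pi> z (0 :: real ^ 'k) m"
proof (cases "z \<in> {0..1}")
  case True
  then show ?thesis using \<pi> m unfolding non_adaptive_policies_def by blast
next
  case False
  have "\<pi> m \<in> sets (restrict_space borel {0..1} \<Otimes>\<^sub>M
      (count_space {xs. length xs = m - 1 \<and> set xs \<subseteq> {0..CARD('k)}} \<Otimes>\<^sub>M borel))"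
    using \<pi> m by (auto simp: non_adaptive_policies_def policies_def)
  from sets.sets_into_space[OF this] False have "question_set \<pi> z u m = {}" for u :: "real ^ 'k"
    by (auto simp: question_set_def space_pair_measure space_restrict_space)
  then show ?thesis by simp
qed

text \<open>The question sets observed at u are also those asked at any other v, so compatibility
  with the history means having the same answer vector.\<close>

lemma consistent_eq: "consistent \<pi> z (u :: real ^ 'k) N = {v. answer_vector \<pi> N z v = answer_vector \<pi> N z u}"
proof -
  have "consistent \<pi> z u N = {v. \<forall>m\<in>{1..N}. target_count (question_set \<pi> z (0 :: real ^ 'k) m) u
          = target_count (question_set \<pi> z (0 :: real ^ 'k) m) v}"
    unfolding consistent_def answer_def by (simp add: question_set_non_adaptive[of _ z u])
  also have "\<dots> = {v. answer_vector \<pi> N z v = answer_vector \<pi> N z u}"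
    unfolding answer_vector_def restrict_eq_iff by (intro Collect_cong ball_cong refl eq_commute)
  finally show ?thesis .
qed

lemma target_count_question_measurable:
  assumes "m \<in> {1..N}" "f \<in> M \<rightarrow>\<^sub>M borel" "g \<in> M \<rightarrow>\<^sub>M borel"
  shows "(\<lambda>x. target_count (question_set \<pi> (f x) (0 :: real ^ 'k) m) (g x :: real ^ 'k)) \<in> M \<rightarrow>\<^sub>M count_space UNIV"
  using measurable_target_count[OF question_set_sets[OF assms(1)] assms(2,3)] by simp

text \<open>Measurability of parametrised integrals is applied twice: to the normalising constant
  \<open>q\<close> and to the entropy integral. Both rest on the joint measurability of "v is
  consistent with (z, u)".\<close>

lemma posterior_entropy_measurable:
  assumes [measurable]: "p \<in> borel_measurable borel"
  shows "(\<lambda>(z, u :: real ^ 'k). differential_entropy (posterior p \<pi> z u N))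
    \<in> borel_measurable (borel \<Otimes>\<^sub>M borel)"
proof -
  let ?B = "(borel \<Otimes>\<^sub>M borel) :: (real \<times> (real ^ 'k)) measure"
  let ?L = "lborel :: (real ^ 'k) measure"
  define c where "c x = consistent \<pi> (fst x) (snd x :: real ^ 'k) N" for x
  define q where "q x = (\<integral>w. indicator (c x) w * p w \<partial>lborel)" for x
  have pred [measurable]: "Measurable.pred (?B \<Otimes>\<^sub>M ?L) (\<lambda>y. snd y \<in> c (fst y))"
  proof -
    have "Measurable.pred (?B \<Otimes>\<^sub>M ?L)
        (\<lambda>y. target_count (question_set \<pi> (fst (fst y)) (0 :: real ^ 'k) m) (snd (fst y))
          = target_count (question_set \<pi> (fst (fst y)) (0 :: real ^ 'k) m) (snd y))" (is "Measurable.pred _ (\<lambda>y. ?f y = ?g y)")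
      if m: "m \<in> {1..N}" for m
      by (intro pred_eq_nat target_count_question_measurable[OF m]) auto
    then have "Measurable.pred (?B \<Otimes>\<^sub>M ?L)
        (\<lambda>y. \<forall>m\<in>{1..N}. target_count (question_set \<pi> (fst (fst y)) (0 :: real ^ 'k) m) (snd (fst y))
          = target_count (question_set \<pi> (fst (fst y)) (0 :: real ^ 'k) m) (snd y))"
      by (intro pred_intros_finite) auto
    then show ?thesis
      unfolding c_def consistent_def answer_def
      by (simp add: question_set_non_adaptive[of _ _ "snd (fst _)"])
  qed
  have ind [measurable]: "(\<lambda>y. indicator (c (fst y)) (snd y) :: real) \<in> borel_measurable (?B \<Otimes>\<^sub>M ?L)"
    by (simp add: indicator_def)
  have q [measurable]: "q \<in> borel_measurable ?B"
    unfolding q_def[abs_def]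
    by (rule lborel.borel_measurable_lebesgue_integral) (simp add: case_prod_beta)
  define d where "d y = indicator (c (fst y)) (snd y) * p (snd y) / q (fst y)" for y
  have [measurable]: "d \<in> borel_measurable (?B \<Otimes>\<^sub>M ?L)"
    unfolding d_def[abs_def] by measurable
  have "(\<lambda>x. - (\<integral>v. d (x, v) * log 2 (d (x, v)) \<partial>lborel)) \<in> borel_measurable ?B"
    by (intro borel_measurable_uminus lborel.borel_measurable_lebesgue_integral)
       (simp add: case_prod_beta)
  also have "(\<lambda>x. - (\<integral>v. d (x, v) * log 2 (d (x, v)) \<partial>lborel))
      = (\<lambda>(z, u). differential_entropy (posterior p \<pi> z u N))"
    unfolding fun_eq_iff split_paired_All prod.case differential_entropy_def posterior_def d_def q_def c_def fst_conv snd_conv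
    by (intro allI refl)
  finally show ?thesis .
qed

end

section \<open>Averaging over the randomisation and the targets\<close>

theorem theorem2:
  fixes M :: "'a measure"
    and f0 :: "real \<Rightarrow> real"
    and \<theta> :: "'a \<Rightarrow> real ^ 'k"
    and Z :: "'a \<Rightarrow> real"
    and N :: nat
    and \<pi> :: policy
  assumes "prob_space M"
    and "\<And>x. f0 x \<ge> 0"
    and "\<And>i. distributed M lborel (\<lambda>\<omega>. \<theta> \<omega> $ i) (\<lambda>x. ennreal (f0 x))"
    and "prob_space.indep_vars M (\<lambda>_. borel) (\<lambda>i \<omega>. \<theta> \<omega> $ i) UNIV"
    and "integrable lborel (\<lambda>u :: real ^ 'k. iid_density f0 u * log 2 (iid_density f0 u))"
    and "Z \<in> borel_measurable M"
    and "distr M borel Z = uniform_measure lborel {0..1}"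
    and "prob_space.indep_set M
           {Z -` A \<inter> space M |A. A \<in> sets borel} {\<theta> -` B \<inter> space M |B. B \<in> sets borel}"
    and "N \<ge> 1"
    and "\<pi> \<in> non_adaptive_policies TYPE('k) N"
  shows "reduction_rate M (iid_density f0) Z \<theta> \<pi> N
           \<le> shannon_entropy (binomial_pmf CARD('k) (1/2))"
proof -
  interpret prob_space M by fact
  note Z = assms(6) and \<pi> = assms(10)
  have \<theta>_nth [measurable]: "(\<lambda>\<omega>. \<theta> \<omega> $ i) \<in> borel_measurable M" for i
    using distributed_measurable[OF assms(3)[of i]] by simp
  then have \<theta>: "\<theta> \<in> borel_measurable M" by (rule borel_measurable_vec)
  define p0 :: "real ^ 'k \<Rightarrow> real" where "p0 = iid_density f0"
  define P where "P = density lborel p0"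
  define \<mu> where "\<mu> = distr M borel Z"
  have P: "P = distr M borel \<theta>"
    unfolding P_def p0_def by (rule distr_iid_density[OF assms(2-4), symmetric])
  have p0_nonneg: "0 \<le> p0 u" for u
    by (simp add: p0_def iid_density_def prod_nonneg assms(2))
  interpret P: prob_space P unfolding P by (rule prob_space_distr[OF \<theta>])
  interpret \<mu>: prob_space \<mu> unfolding \<mu>_def by (rule prob_space_distr[OF Z])
  interpret pair: pair_sigma_finite \<mu> P ..
  have f0_meas [measurable]: "f0 \<in> borel_measurable borel"
    by (rule distributed_real_measurable[OF assms(2) assms(3)[of undefined], simplified])
  have p0_meas [measurable]: "p0 \<in> borel_measurable borel"
    unfolding p0_def iid_density_def[abs_def] by measurable
  have p0_int: "integrable lborel p0"
    using P.emeasure_space_1 p0_nonneg unfolding P_def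
    by (intro integrableI_nonneg) (auto simp: emeasure_density)
  note p0 = p0_nonneg p0_int
  have int: "integrable lborel (\<lambda>u. p0 u * log 2 (p0 u))"
    unfolding p0_def by fact
  let ?k = "CARD('k)"
  let ?X = "answer_vector \<pi> N :: real \<Rightarrow> real ^ 'k \<Rightarrow> nat \<Rightarrow> nat"
  define S where "S = PiE {1..N} (\<lambda>_. {..?k})"
  define h where "h z u = differential_entropy (posterior p0 \<pi> z u N)" for z u
  define H where "H = binomial_entropy ?k (1/2) / ln 2"
  define Q where "Q z x = P.prob {u. ?X z u = x}" for z x
  have space_P: "space P = UNIV" and sets_P [measurable_cong]: "sets P = sets borel"
    by (simp_all add: P_def)
  have sets_\<mu> [measurable_cong]: "sets \<mu> = sets borel" by (simp add: \<mu>_def)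
  have tc [measurable]: "(\<lambda>u. target_count (question_set \<pi> z (0 :: real ^ 'k) m) (u :: real ^ 'k)) \<in> borel \<rightarrow>\<^sub>M count_space UNIV"
    if "m \<in> {1..N}" for z m
    using target_count_question_measurable[OF \<pi> that, where f = "\<lambda>_. z" and g = "\<lambda>u. u" and M = borel]
    by simp
  have X_S: "?X z u \<in> S" for z u
    by (auto simp: answer_vector_def S_def target_count_le)
  have X_sets: "{u. ?X z u = x} \<in> sets borel" if "x \<in> S" for z x
  proof -
    have "{u. ?X z u = x} = {u \<in> space borel. \<forall>m\<in>{1..N}. target_count (question_set \<pi> z (0 :: real ^ 'k) m) u = x m}"
      using that by (auto simp: answer_vector_def S_def fun_eq_iff PiE_iff extensional_def)
    also have "\<dots> \<in> sets borel" by measurable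
    finally show ?thesis .
  qed
  have finS: "finite S" by (simp add: S_def finite_PiE)
  have h_eq: "h z = (\<lambda>u. differential_entropy (\<lambda>v. indicator {v. ?X z v = ?X z u} v * p0 v
                  / (\<integral>w. indicator {v. ?X z v = ?X z u} w * p0 w \<partial>lborel)))" for z
    unfolding h_def posterior_def consistent_eq[OF \<pi>] ..
  note conditioned = expected_conditioned_entropy
    [OF p0 int P.prob_space_axioms[unfolded P_def] finS X_S X_sets]
  have h: "integrable P (h z)"
    "(\<integral>u. h z u \<partial>P) = differential_entropy p0 + (\<Sum>x\<in>S. Q z x * log 2 (Q z x))"
    "(\<integral>u. \<bar>h z u\<bar> \<partial>P) \<le> (\<integral>u. \<bar>p0 u * log 2 (p0 u)\<bar> \<partial>lborel) - (\<Sum>x\<in>S. Q z x * log 2 (Q z x))" for z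
    unfolding h_eq Q_def P_def by (rule conditioned; assumption)+
  \<comment> \<open>The bound is free of z. It gives both the pointwise estimate and the constant
    that dominates the integrand in Fubini's theorem.\<close>
  have entropy: "- (\<Sum>x\<in>S. Q z x * log 2 (Q z x)) \<le> real N * H" for z
  proof -
    let ?T = "\<lambda>m (u :: real ^ 'k). target_count (question_set \<pi> z (0 :: real ^ 'k) m) u"
    have marginal: "- (\<Sum>j\<le>?k. P.prob {u \<in> space P. ?T m u = j} * ln (P.prob {u \<in> space P. ?T m u = j}))
        \<le> binomial_entropy ?k (1/2)" if m: "m \<in> {1..N}" for m
    proof -
      define A where "A = question_set \<pi> z (0 :: real ^ 'k) m"
      have "Pair z -` {(z, t). t \<in> question_set \<pi> z (0 :: real ^ 'k) m} \<in> sets borel"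
        by (rule sets_Pair1[OF question_set_sets[OF \<pi> m]])
      then have A [measurable]: "A \<in> sets borel" by (simp add: A_def vimage_def)
      \<comment> \<open>This parameter is common to all targets but varies with z and m; maximality
        at 1/2 removes the dependence.\<close>
      define q where "q = measure (density lborel f0) A"
      have q: "prob {\<omega> \<in> space M. \<theta> \<omega> $ i \<in> A} = q" for i
      proof -
        have "distr M lborel (\<lambda>\<omega>. \<theta> \<omega> $ i) = density lborel f0"
          by (rule distributed_distr_eq_density[OF assms(3)])
        then show ?thesis
          by (simp add: q_def measure_distr vimage_def Int_def conj_commute flip: \<open>distr M lborel _ = _\<close>)
      qed
      have q01: "0 \<le> q" "q \<le> 1" unfolding q[of undefined, symmetric] by auto
      have "P.prob {u \<in> space P. target_count A u = j} = Bernstein ?k j q" for j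
      proof -
        have "{u :: real ^ 'k. target_count A u = j} \<in> sets borel"
          using measurable_sets[OF tc[OF m, of z], of "{j}"] by (simp add: A_def vimage_def)
        then have "P.prob {u \<in> space P. target_count A u = j} = prob {\<omega> \<in> space M. target_count A (\<theta> \<omega>) = j}"
          unfolding P using \<theta> by (simp add: measure_distr vimage_def Int_def conj_commute)
        then show ?thesis
          using prob_target_count[OF assms(4) A q] by simp
      qed
      then show ?thesis
        using binomial_entropy_le_half[OF q01, of ?k] by (simp add: A_def[symmetric] binomial_entropy_def)
    qed
    have Q_eq: "Q z x = P.prob {u \<in> space P. (\<lambda>m\<in>{1..N}. ?T m u) = x}" for x
      by (simp add: Q_def answer_vector_def space_P)
    have "- (\<Sum>x\<in>S. Q z x * ln (Q z x)) \<le> (\<Sum>m\<in>{1..N}. - (\<Sum>j\<le>?k.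
        P.prob {u \<in> space P. ?T m u = j} * ln (P.prob {u \<in> space P. ?T m u = j})))"
      unfolding S_def Q_eq
    proof (rule P.joint_entropy_le_sum_entropies)
      show "?T m \<in> P \<rightarrow>\<^sub>M count_space UNIV" if "m \<in> {1..N}" for m
        using tc[OF that] by (simp add: measurable_cong_sets[OF sets_P refl])
    qed (auto simp: target_count_le)
    also have "\<dots> \<le> (\<Sum>m\<in>{1..N}. binomial_entropy ?k (1/2))"
      by (intro sum_mono marginal)
    finally have "- (\<Sum>x\<in>S. Q z x * ln (Q z x)) / ln 2 \<le> real N * binomial_entropy ?k (1/2) / ln 2"
      by (intro divide_right_mono) auto
    then show ?thesis
      by (simp add: H_def log_def sum_divide_distrib)
  qed
  \<comment> \<open>Independence of Z and \<theta> permits integrating over \<theta> first with z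
    held fixed, where the questions are deterministic.\<close>
  have joint: "distr M (borel \<Otimes>\<^sub>M borel) (\<lambda>\<omega>. (Z \<omega>, \<theta> \<omega>)) = \<mu> \<Otimes>\<^sub>M P"
  proof (rule pair_measure_eqI[symmetric])
    have pair: "(\<lambda>\<omega>. (Z \<omega>, \<theta> \<omega>)) \<in> M \<rightarrow>\<^sub>M borel \<Otimes>\<^sub>M borel"
      using Z \<theta> by measurable
    fix A B assume "A \<in> sets \<mu>" "B \<in> sets P"
    then have AB: "A \<in> sets borel" "B \<in> sets borel" by (simp_all add: sets_\<mu> sets_P)
    have "emeasure \<mu> A * emeasure P B = prob (Z -` A \<inter> space M) * prob (\<theta> -` B \<inter> space M)"
      using AB Z \<theta> by (simp add: \<mu>_def P emeasure_distr emeasure_eq_measure ennreal_mult)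
    also have "prob (Z -` A \<inter> space M) * prob (\<theta> -` B \<inter> space M)
        = prob ((Z -` A \<inter> space M) \<inter> (\<theta> -` B \<inter> space M))"
      using AB by (intro indep_setD[OF assms(8), symmetric]) auto
    also have "(Z -` A \<inter> space M) \<inter> (\<theta> -` B \<inter> space M) = (\<lambda>\<omega>. (Z \<omega>, \<theta> \<omega>)) -` (A \<times> B) \<inter> space M"
      by auto
    also have "ennreal (prob ((\<lambda>\<omega>. (Z \<omega>, \<theta> \<omega>)) -` (A \<times> B) \<inter> space M))
        = emeasure (distr M (borel \<Otimes>\<^sub>M borel) (\<lambda>\<omega>. (Z \<omega>, \<theta> \<omega>))) (A \<times> B)"
      using AB by (simp add: emeasure_distr[OF pair] emeasure_eq_measure)
    finally show "emeasure \<mu> A * emeasure P B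
        = emeasure (distr M (borel \<Otimes>\<^sub>M borel) (\<lambda>\<omega>. (Z \<omega>, \<theta> \<omega>))) (A \<times> B)" .
  qed (simp_all add: \<mu>.sigma_finite_measure_axioms P.sigma_finite_measure_axioms
         sets_pair_measure_cong[OF sets_\<mu> sets_P])
  have h_meas: "(\<lambda>x. h (fst x) (snd x)) \<in> borel_measurable (\<mu> \<Otimes>\<^sub>M P)"
    using posterior_entropy_measurable[OF \<pi> p0_meas]
    by (simp add: h_def case_prod_beta cong: measurable_cong_sets sets_pair_measure_cong)
  have h_int: "integrable (\<mu> \<Otimes>\<^sub>M P) (\<lambda>x. h (fst x) (snd x))"
  proof (rule pair.Fubini_integrable[OF h_meas])
    note [measurable] = h_meas
    have "(\<integral>u. \<bar>h z u\<bar> \<partial>P) \<le> (\<integral>u. \<bar>p0 u * log 2 (p0 u)\<bar> \<partial>lborel) + real N * H" for z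
      using h(3)[of z] entropy[of z] by linarith
    then show "integrable \<mu> (\<lambda>z. \<integral>u. norm (h (fst (z, u)) (snd (z, u))) \<partial>P)"
      by (intro \<mu>.integrable_const_bound) (auto intro!: AE_I2)
    show "AE z in \<mu>. integrable P (\<lambda>u. h (fst (z, u)) (snd (z, u)))"
      using h(1) by simp
  qed
  have "differential_entropy p0 - real N * H \<le> (\<integral>z. (\<integral>u. h z u \<partial>P) \<partial>\<mu>)"
  proof (rule \<mu>.integral_ge_const)
    show "integrable \<mu> (\<lambda>z. \<integral>u. h z u \<partial>P)"
      using pair.integrable_fst'[OF h_int] by simp
    have "differential_entropy p0 - real N * H \<le> (\<integral>u. h z u \<partial>P)" for z
      using h(2)[of z] entropy[of z] by linarith
    then show "AE z in \<mu>. differential_entropy p0 - real N * H \<le> (\<integral>u. h z u \<partial>P)"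
      by simp
  qed
  also have "\<dots> = (\<integral>x. h (fst x) (snd x) \<partial>(\<mu> \<Otimes>\<^sub>M P))"
    using pair.integral_fst'[OF h_int] by simp
  also have "\<dots> = (\<integral>\<omega>. h (Z \<omega>) (\<theta> \<omega>) \<partial>M)"
    unfolding joint[symmetric] using Z \<theta> h_meas
    by (subst integral_distr) (auto simp: joint[symmetric])
  finally have "differential_entropy p0 - (\<integral>\<omega>. h (Z \<omega>) (\<theta> \<omega>) \<partial>M) \<le> real N * H"
    by simp
  then have "(differential_entropy p0 - (\<integral>\<omega>. h (Z \<omega>) (\<theta> \<omega>) \<partial>M)) / real N \<le> H"
    using assms(9) by (simp add: field_simps)
  then show ?thesis
    unfolding reduction_rate_def by (simp add: h_def p0_def H_def shannon_entropy_binomial_pmf)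
qed

end
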